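(* The class $\mathcal{S}^*_{Ne}$ satisfies the following inclusion properties: (a) $\mathcal{S}^*_{Ne}\subset\mathcal{S}^*(\alpha)$ whenever $0\leq\alpha\leq1-\frac{2\sqrt{2}}{3}$. (b) $\mathcal{S}^*_{Ne}\subset\mathcal{SS}^*(\beta)$ whenever $\beta_0\leq\beta\leq1$, where $\beta_0=\frac{2}{\pi}\arctan(4\sqrt5)\approx0.929121$. (c) $\mathcal{S}^*_{q_c}\subset\mathcal{S}^*_{Ne}$ whenever $0<c\leq\frac{8}{9}$. (d) $k\text{-}\mathcal{ST}\subset\mathcal{S}^*_{Ne}$ whenever $k\geq\frac{5}{2}$. (e) $\mathcal{S}^*_{\alpha,e}\subset\mathcal{S}^*_{Ne}$ whenever $1-\frac{2/3}{e-1}\leq\alpha<1$. (f) $\mathcal{S}^*_L(\alpha)\subset\mathcal{S}^*_{Ne}$ whenever $\frac{1}{3}\leq\alpha<1$. The constant in each part is best possible: the constants $1-\frac{2\sqrt2}{3}$ in (a) and $\frac89$ in (c) cannot be replaced by larger ones, and the constants $\beta_0$ in (b), $\frac52$ in (d), $1-\frac{2/3}{e-1}$ in (e) and $\frac13$ in (f) cannot be replaced by smaller ones.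
   Context: $\mathbb{D}$ is the open unit disk. $\mathcal{A}$ is the set of analytic functions $f$ on $\mathbb{D}$ with $f(0)=0$ and $f'(0)=1$. For analytic $f,g$ on $\mathbb{D}$, $f\prec g$ means there is an analytic $w$ on $\mathbb{D}$ with $w(0)=0$, $|w(z)|<1$ and $f(z)=g(w(z))$ on $\mathbb{D}$. For analytic $\varphi$ on $\mathbb{D}$ with $\varphi(0)=1$, $\mathcal{S}^*(\varphi)=\{f\in\mathcal{A}: zf'(z)/f(z)\prec\varphi(z)\}$. Definitions of the classes: $\mathcal{S}^*_{Ne}=\mathcal{S}^*(1+z-z^3/3)$; $\mathcal{S}^*(\alpha)=\{f\in\mathcal{A}:\mathrm{Re}(zf'(z)/f(z))>\alpha \text{ on } \mathbb{D}\}$ for $0\le\alpha<1$; $\mathcal{SS}^*(\beta)=\{f\in\mathcal{A}:|\arg(zf'(z)/f(z))|<\beta\pi/2 \text{ on } \mathbb{D}\}$ for $0<\beta\le1$; $\mathcal{S}^*_{q_c}=\mathcal{S}^*(\sqrt{1+cz})$ for $0<c\le1$; $k\text{-}\mathcal{ST}$ ($k\ge0$), the $k$-uniformly starlike functions: $f\in\mathcal{A}$ such that $zf'(z)/f(z)$ is analytic on $\mathbb{D}$ with values in the conic region $\{w\in\mathbb{C}:\mathrm{Re}\,w>k|w-1|\}$ (for $k>1$ this is the interior of the ellipse $\left(u-\frac{k^2}{k^2-1}\right)^2\big/\left(\frac{k}{k^2-1}\right)^2+(k^2-1)v^2=1$, $w=u+iv$); $\mathcal{S}^*_{\alpha,e}=\mathcal{S}^*(\alpha+(1-\alpha)e^z)$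 and $\mathcal{S}^*_L(\alpha)=\mathcal{S}^*(\alpha+(1-\alpha)\sqrt{1+z})$ for $0\le\alpha<1$. Principal branches of square roots and of $\arg$ are used. *)

theory Defs
  imports "HOL-Complex_Analysis.Complex_Analysis"
begin

text \<open>
  Functions on the unit disk are total functions of type complex to complex; only their
  restriction to the disk matters in what follows.
\<close>

definition normalized_analytic :: "(complex \<Rightarrow> complex) set" where
  "normalized_analytic = {f. f holomorphic_on ball 0 1 \<and> f 0 = 0 \<and> deriv f 0 = 1}"

definition subordinate :: "(complex \<Rightarrow> complex) \<Rightarrow> (complex \<Rightarrow> complex) \<Rightarrow> bool"
    (infix "\<prec>\<^sub>D" 50) where
  "f \<prec>\<^sub>D g \<longleftrightarrow> f holomorphic_on ball 0 1 \<and> g holomorphic_on ball 0 1 \<and>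
     (\<exists>w. w holomorphic_on ball 0 1 \<and> w 0 = 0 \<and>
          (\<forall>z\<in>ball 0 1. cmod (w z) < 1) \<and> (\<forall>z\<in>ball 0 1. f z = g (w z)))"

text \<open>
  The function \<open>z f'(z) / f(z)\<close>. At the origin it is given its limit \<open>1\<close> for normalized \<open>f\<close>,
  because Isabelle's \<open>0 / 0\<close> is \<open>0\<close>. A zero of \<open>f\<close> elsewhere in the disk is a pole of the
  quotient, where Isabelle's division by zero again gives the value \<open>0\<close>. The classes below
  therefore require the quotient to be holomorphic on the whole disk, which rules out such zeros.
\<close>

definition starlike_quot :: "(complex \<Rightarrow> complex) \<Rightarrow> complex \<Rightarrow> complex" where
  "starlike_quot f z = (if z = 0 then 1 else z * deriv f z / f z)"

definition S_phi :: "(complex \<Rightarrow> complex) \<Rightarrow> (complex \<Rightarrow> complex) set" where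
  "S_phi \<phi> = {f \<in> normalized_analytic. starlike_quot f \<prec>\<^sub>D \<phi>}"

definition S_Ne :: "(complex \<Rightarrow> complex) set" where
  "S_Ne = S_phi (\<lambda>z. 1 + z - z ^ 3 / 3)"

definition S_order :: "real \<Rightarrow> (complex \<Rightarrow> complex) set" where
  "S_order \<alpha> = {f \<in> normalized_analytic. starlike_quot f holomorphic_on ball 0 1 \<and>
     (\<forall>z\<in>ball 0 1. Re (starlike_quot f z) > \<alpha>)}"

text \<open>
  The quotient is required to be nonzero since its argument must be defined; in Isabelle \<open>Arg 0\<close>
  is \<open>0\<close>.
\<close>

definition SS_order :: "real \<Rightarrow> (complex \<Rightarrow> complex) set" where
  "SS_order \<beta> = {f \<in> normalized_analytic. starlike_quot f holomorphic_on ball 0 1 \<and>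
     (\<forall>z\<in>ball 0 1. starlike_quot f z \<noteq> 0 \<and> \<bar>Arg (starlike_quot f z)\<bar> < \<beta> * pi / 2)}"

definition S_qc :: "real \<Rightarrow> (complex \<Rightarrow> complex) set" where
  "S_qc c = S_phi (\<lambda>z. csqrt (1 + of_real c * z))"

definition conic_region :: "real \<Rightarrow> complex set" where
  "conic_region k = {w. Re w > k * cmod (w - 1)}"

definition k_ST :: "real \<Rightarrow> (complex \<Rightarrow> complex) set" where
  "k_ST k = {f \<in> normalized_analytic. starlike_quot f holomorphic_on ball 0 1 \<and>
     (\<forall>z\<in>ball 0 1. starlike_quot f z \<in> conic_region k)}"

definition S_exp :: "real \<Rightarrow> (complex \<Rightarrow> complex) set" where
  "S_exp \<alpha> = S_phi (\<lambda>z. of_real \<alpha> + (1 - of_real \<alpha>) * exp z)"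

definition S_L :: "real \<Rightarrow> (complex \<Rightarrow> complex) set" where
  "S_L \<alpha> = S_phi (\<lambda>z. of_real \<alpha> + (1 - of_real \<alpha>) * csqrt (1 + z))"

definition beta0 :: real where
  "beta0 = 2 / pi * arctan (4 * sqrt 5)"

end

theory Submission
  imports Defs
begin

text \<open>
  The map \<open>\<phi>(z) = 1 + z - z\<^sup>3/3\<close> is injective on the disk. Parts (a) and (b) bound a real-linear
  functional of \<open>\<phi>\<close> on the unit circle and then apply the maximum principle. For (c) to (f), if
  \<open>q\<close> is holomorphic on the disk, \<open>q(0) = 1\<close>, and \<open>q\<close> omits the nephroid curve, that is, the
  \<open>\<phi>\<close>-image of the circle, then connectedness puts the image of \<open>q\<close> inside the \<open>\<phi>\<close>-image of the
  disk, and \<open>\<phi>\<inverse> \<circ> q\<close> is the required Schwarz function. Optimality in (c) to (f) holds because the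
  only real numbers in the \<open>\<phi>\<close>-image of the disk are those strictly between \<open>1/3\<close> and \<open>5/3\<close>.
\<close>

section \<open>Functions on the disk\<close>

text \<open>The maximum principle for \<open>- f\<close> gives the weak inequality. It is strict
  because the image is open: a value of real part \<open>B\<close> could be shifted left inside the
  image, violating the weak bound.\<close>

lemma Re_gt_interior:
  assumes hol: "f holomorphic_on ball 0 1" and cont: "continuous_on (cball 0 1) f"
    and inj: "inj_on f (ball 0 1)"
    and bound: "\<And>z. norm z = 1 \<Longrightarrow> B \<le> Re (f z)"
    and z: "z \<in> ball 0 1"
  shows "B < Re (f z)"
proof -
  have weak: "B \<le> Re (f w)" if "w \<in> ball 0 1" for w
  proof -
    have "Re (- f w) \<le> - B"
    proof (rule maximum_real_frontier[of "\<lambda>z. - f z" "ball 0 1"])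
      show "(\<lambda>z. - f z) holomorphic_on interior (ball 0 1)"
        using hol by (simp add: holomorphic_on_minus)
      show "continuous_on (closure (ball 0 1)) (\<lambda>z. - f z)"
        using cont by (simp add: continuous_on_minus)
      show "Re (- f z) \<le> - B" if "z \<in> frontier (ball 0 1)" for z
        using bound[of z] that by simp
    qed (use that in auto)
    then show ?thesis by simp
  qed
  have "open (f ` ball 0 1)"
    using hol inj by (intro open_mapping_thm3) auto
  then obtain e where e: "e > 0" "cball (f z) e \<subseteq> f ` ball 0 1"
    using z open_contains_cball by blast
  have "f z - of_real e \<in> cball (f z) e"
    using e by (simp add: dist_norm)
  then obtain w where w: "w \<in> ball 0 1" "f w = f z - of_real e"
    using e by (metis imageE subsetD)
  then show ?thesis
    using weak[OF w(1)] e(1) by simp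
qed

text \<open>Solves \<open>z f' / f = q\<close> by \<open>f(z) = z exp (G z - G 0)\<close> with
  \<open>G\<close> a primitive of \<open>(q - 1) / z\<close>. This supplies the extremal functions
  for the optimality claims.\<close>

lemma exists_starlike_quot:
  assumes q: "q holomorphic_on ball 0 1" "q 0 = 1"
  obtains f where "f \<in> normalized_analytic"
    "\<And>z. z \<in> ball 0 1 \<Longrightarrow> starlike_quot f z = q z"
proof -
  \<comment> \<open>The value \<open>deriv q 0\<close> at the origin removes the singularity of
    \<open>(q z - 1) / z\<close>.\<close>
  define h where "h = (\<lambda>z. if z = 0 then deriv q 0 else (q z - q 0) / (z - 0))"
  have h: "h holomorphic_on ball 0 1"
    unfolding h_def by (rule pole_lemma_open) (use q in auto)
  obtain G where G: "\<And>z. z \<in> ball 0 1 \<Longrightarrow> (G has_field_derivative h z) (at z within ball 0 1)"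
    using holomorphic_convex_primitive'[OF _ _ h] by auto
  have G': "(G has_field_derivative h z) (at z)" if "z \<in> ball 0 1" for z
    using G[OF that] that by (metis at_within_open open_ball)
  define f where "f = (\<lambda>z. z * exp (G z - G 0))"
  have f: "(f has_field_derivative exp (G z - G 0) * (1 + z * h z)) (at z)"
    if "z \<in> ball 0 1" for z
    unfolding f_def using G'[OF that]
    by (auto intro!: derivative_eq_intros simp: algebra_simps)
  have deriv: "deriv f z = exp (G z - G 0) * (1 + z * h z)" if "z \<in> ball 0 1" for z
    using f[OF that] by (rule DERIV_imp_deriv)
  have "f holomorphic_on ball 0 1"
    using f by (meson holomorphic_onI has_field_derivative_at_within field_differentiable_def)
  moreover have "f 0 = 0" by (simp add: f_def)
  moreover have "deriv f 0 = 1" by (simp add: deriv)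
  ultimately have "f \<in> normalized_analytic"
    by (simp add: normalized_analytic_def)
  moreover have "starlike_quot f z = q z" if "z \<in> ball 0 1" for z
  proof (cases "z = 0")
    case True
    then show ?thesis by (simp add: starlike_quot_def q)
  next
    case False
    then have "1 + z * h z = q z" by (simp add: h_def q)
    then show ?thesis
      using False deriv[OF that] by (simp add: starlike_quot_def f_def)
  qed
  ultimately show ?thesis using that by blast
qed

lemma exists_S_phi_quot:
  assumes "\<phi> holomorphic_on ball 0 1" "\<phi> 0 = 1"
  obtains f where "f \<in> S_phi \<phi>" "\<And>z. z \<in> ball 0 1 \<Longrightarrow> starlike_quot f z = \<phi> z"
proof -
  obtain f where f: "f \<in> normalized_analytic"
    "\<And>z. z \<in> ball 0 1 \<Longrightarrow> starlike_quot f z = \<phi> z"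
    using exists_starlike_quot[OF assms] by blast
  have "starlike_quot f holomorphic_on ball 0 1"
    using assms(1) by (rule holomorphic_transform) (simp add: f)
  then have "starlike_quot f \<prec>\<^sub>D \<phi>"
    unfolding subordinate_def using assms(1) f(2)
    by (intro conjI exI[of _ "\<lambda>z. z"]) auto
  with f that show ?thesis by (auto simp: S_phi_def)
qed

lemma S_phi_image:
  assumes "f \<in> S_phi \<phi>" "z \<in> ball 0 1"
  shows "starlike_quot f z \<in> \<phi> ` ball 0 1"
  using assms by (auto simp: S_phi_def subordinate_def)

section \<open>The nephroid map\<close>

definition nephroid :: "complex \<Rightarrow> complex" where
  "nephroid z = 1 + z - z ^ 3 / 3"

lemma S_Ne_nephroid: "S_Ne = S_phi nephroid"
  by (simp add: S_Ne_def nephroid_def[abs_def])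

lemma nephroid_0 [simp]: "nephroid 0 = 1"
  by (simp add: nephroid_def)

lemma nephroid_holomorphic [holomorphic_intros]: "nephroid holomorphic_on A"
  unfolding nephroid_def[abs_def] by (intro holomorphic_intros) auto

lemma nephroid_continuous: "continuous_on A nephroid"
  by (intro holomorphic_on_imp_continuous_on holomorphic_intros)

text \<open>A difference of values factors as
  \<open>(z - w) * (3 - (z^2 + z * w + w^2)) / 3\<close>, and the second factor cannot vanish: the
  three terms have moduli at most 1, the first strictly less.\<close>

lemma nephroid_eq_imp_eq:
  assumes "norm z < 1" "norm w \<le> 1" "nephroid z = nephroid w"
  shows "z = w"
proof (rule ccontr)
  assume "z \<noteq> w"
  have "(z - w) * (3 - (z^2 + z * w + w^2)) = 3 * (nephroid z - nephroid w)"
    by (simp add: nephroid_def field_simps power2_eq_square power3_eq_cube)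
  also have "\<dots> = 0" using assms(3) by simp
  finally have "3 - (z^2 + z * w + w^2) = 0"
    using \<open>z \<noteq> w\<close> by (metis mult_eq_0_iff eq_iff_diff_eq_0)
  then have "z^2 + z * w + w^2 = 3" by (metis eq_iff_diff_eq_0)
  then have "3 \<le> norm (z^2) + norm (z * w) + norm (w^2)"
    using norm_triangle_mono[OF norm_triangle_ineq[of "z^2" "z * w"] order_refl[of "norm (w^2)"]]
    by simp
  moreover have "norm (z^2) < 1" "norm (w^2) \<le> 1"
    using assms by (auto simp: norm_power power_less_one_iff power_le_one)
  moreover have "norm (z * w) \<le> 1"
    using assms by (simp add: norm_mult mult_le_one)
  ultimately show False by linarith
qed

lemma nephroid_inj: "inj_on nephroid (ball 0 1)"
  by (rule inj_onI, rule nephroid_eq_imp_eq) auto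

text \<open>\<open>nephroid\<close> commutes with conjugation, so injectivity forces the preimage of
  a real value to be real. What remains is a real cubic on \<open>(-1, 1)\<close>.\<close>

lemma nephroid_real_image:
  assumes "of_real x \<in> nephroid ` ball 0 1"
  shows "1 / 3 < x" "x < 5 / 3"
proof -
  obtain z where z: "norm z < 1" "nephroid z = of_real x"
    using assms by auto
  have "nephroid (cnj z) = cnj (nephroid z)"
    by (simp add: nephroid_def)
  with z have "cnj z = z"
    by (intro nephroid_eq_imp_eq[of "cnj z" z]) simp_all
  then have "z \<in> \<real>" by (rule iffD2[OF Reals_cnj_iff])
  then obtain t where t: "z = of_real t" by (rule Reals_cases)
  have "nephroid (of_real t) = of_real (1 + t - t^3 / 3)"
    by (simp add: nephroid_def)
  then have "complex_of_real x = of_real (1 + t - t^3 / 3)"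
    using z(2) unfolding t by (simp only:)
  then have x: "x = 1 + t - t^3 / 3"
    by (simp only: of_real_eq_iff)
  have t1: "-1 < t" "t < 1" using z(1) unfolding t by simp_all
  \<comment> \<open>These products are \<open>3 * x - 1\<close> and \<open>5 - 3 * x\<close>; their
    double roots are the critical points -1 and 1 of the cubic.\<close>
  then have "0 < (1 + t)^2 * (2 - t)" "0 < (1 - t)^2 * (2 + t)"
    by (simp_all add: zero_less_mult_iff)
  then show "1 / 3 < x" "x < 5 / 3"
    unfolding x by (simp_all add: algebra_simps power2_eq_square power3_eq_cube)
qed

section \<open>The boundary curve in terms of the real part\<close>

text \<open>Eliminating \<open>Im \<zeta>\<close> through \<open>x^2 + y^2 = 1\<close> turns the
  later estimates on the curve into polynomial inequalities in \<open>x\<close> on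
  \<open>[-1, 1]\<close>.\<close>

lemma nephroid_circle:
  assumes "norm \<zeta> = 1"
  defines "x \<equiv> Re \<zeta>"
  shows "Re (nephroid \<zeta>) = 1 + 2 * x - 4 * x^3 / 3"
    and "Im (nephroid \<zeta>) = 4 / 3 * (Im \<zeta>)^3"
    and "(norm (nephroid \<zeta> - 1))\<^sup>2 = 16 / 9 - 4 / 3 * x^2"
    and "(norm (nephroid \<zeta> + 1))\<^sup>2 = 52 / 9 + 8 * x - 4 / 3 * x^2 - 16 / 3 * x^3"
    and "(Im \<zeta>)\<^sup>2 = 1 - x\<^sup>2" "-1 \<le> x" "x \<le> 1"
proof -
  define y where "y = Im \<zeta>"
  have \<zeta>: "\<zeta> = Complex x y" by (simp add: x_def y_def)
  have xy: "x^2 + y^2 = 1"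
    using assms(1) by (simp add: \<zeta> complex_norm)
  then have y2: "y^2 = 1 - x^2" by simp
  show "(Im \<zeta>)\<^sup>2 = 1 - x\<^sup>2" using y2 by (simp add: y_def)
  show "-1 \<le> x" "x \<le> 1"
    using abs_Re_le_cmod[of \<zeta>] assms by auto
  have re: "Re (nephroid \<zeta>) = 1 + x - (x^3 - 3 * x * y^2) / 3"
    and im: "Im (nephroid \<zeta>) = y - (3 * x^2 * y - y * y^2) / 3"
    by (simp_all add: nephroid_def \<zeta> power2_eq_square power3_eq_cube algebra_simps)
  show R: "Re (nephroid \<zeta>) = 1 + 2 * x - 4 * x^3 / 3"
    unfolding re y2 by (simp add: field_simps power2_eq_square power3_eq_cube)
  have x2: "x^2 = 1 - y^2" using xy by simp
  show I: "Im (nephroid \<zeta>) = 4 / 3 * (Im \<zeta>)^3"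
    unfolding im x2 y_def[symmetric] by (simp add: field_simps power2_eq_square power3_eq_cube)
  have "y^6 = (y^2)^3" by simp
  then have y6: "y^6 = (1 - x^2)^3" unfolding y2 .
  have I2: "(Im (nephroid \<zeta>))^2 = 16 / 9 * (1 - x^2)^3"
    unfolding I y_def[symmetric] using y6 by (simp add: power_mult_distrib power2_eq_square)
  show "(norm (nephroid \<zeta> - 1))\<^sup>2 = 16 / 9 - 4 / 3 * x^2"
    unfolding cmod_power2 minus_complex.simps I2 R one_complex.simps
    using I2 by (simp add: field_simps) (simp add: algebra_simps power_numeral_reduce)
  show "(norm (nephroid \<zeta> + 1))\<^sup>2 = 52 / 9 + 8 * x - 4 / 3 * x^2 - 16 / 3 * x^3"
    unfolding cmod_power2 plus_complex.simps I2 R one_complex.simps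
    using I2 by (simp add: field_simps) (simp add: algebra_simps power_numeral_reduce)
qed

section \<open>Subordination to the nephroid map\<close>

text \<open>On the image of \<open>q\<close>, the images of the open and the closed disk leave the
  same trace. That trace is relatively open and closed and contains \<open>q 0 = 1\<close>, so it is
  everything.\<close>

lemma nephroid_image_omit:
  fixes q :: "complex \<Rightarrow> complex"
  assumes q: "continuous_on (ball 0 1) q" "q 0 = 1"
    and omit: "\<And>z \<zeta>. norm z < 1 \<Longrightarrow> norm \<zeta> = 1 \<Longrightarrow> q z \<noteq> nephroid \<zeta>"
  shows "q ` ball 0 1 \<subseteq> nephroid ` ball 0 1"
proof -
  let ?S = "q ` ball 0 1"
  have "connected ?S"
    using q(1) by (simp add: connected_continuous_image)
  moreover have eq: "?S \<inter> nephroid ` ball 0 1 = ?S \<inter> nephroid ` cball 0 1"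
    using omit by (force simp: less_le)
  moreover have "open (nephroid ` ball 0 1)"
    by (intro open_mapping_thm3 holomorphic_intros nephroid_inj) auto
  moreover have "closed (nephroid ` cball 0 1)"
    by (intro compact_imp_closed compact_continuous_image nephroid_continuous) auto
  ultimately have "?S \<inter> nephroid ` ball 0 1 = {} \<or> ?S \<inter> nephroid ` ball 0 1 = ?S"
    by (metis connected_clopen openin_open_Int closedin_closed_Int)
  moreover have "1 \<in> ?S \<inter> nephroid ` ball 0 1"
    by (metis IntI q(2) nephroid_0 centre_in_ball zero_less_one imageI)
  ultimately show ?thesis by blast
qed

lemma subordinate_nephroid:
  assumes q: "q holomorphic_on ball 0 1" "q 0 = 1"
    and omit: "\<And>z \<zeta>. norm z < 1 \<Longrightarrow> norm \<zeta> = 1 \<Longrightarrow> q z \<noteq> nephroid \<zeta>"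
  shows "q \<prec>\<^sub>D nephroid"
proof -
  have sub: "q ` ball 0 1 \<subseteq> nephroid ` ball 0 1"
    by (rule nephroid_image_omit[OF holomorphic_on_imp_continuous_on[OF q(1)] q(2) omit])
  obtain g where g: "g holomorphic_on (nephroid ` ball 0 1)"
    "\<And>z. z \<in> ball 0 1 \<Longrightarrow> g (nephroid z) = z"
    by (rule holomorphic_has_inverse[OF nephroid_holomorphic open_ball nephroid_inj]) (rule that)
  have "(\<lambda>z. g (q z)) holomorphic_on ball 0 1"
    using holomorphic_on_compose_gen[OF q(1) g(1) sub] by (simp add: o_def)
  moreover have "g (q 0) = 0"
    using g(2)[of 0] by (simp add: q)
  moreover have "norm (g (q z)) < 1 \<and> q z = nephroid (g (q z))" if z: "z \<in> ball 0 1" for z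
  proof -
    obtain w where "w \<in> ball 0 1" "q z = nephroid w"
      using sub z by blast
    then show ?thesis using g(2)[of w] by simp
  qed
  ultimately show ?thesis
    unfolding subordinate_def
    by (intro conjI exI[of _ "\<lambda>z. g (q z)"] q(1) nephroid_holomorphic) auto
qed

lemma S_phi_subset_S_Ne:
  assumes "\<phi> 0 = 1"
    and "\<And>z \<zeta>. norm z < 1 \<Longrightarrow> norm \<zeta> = 1 \<Longrightarrow> \<phi> z \<noteq> nephroid \<zeta>"
  shows "S_phi \<phi> \<subseteq> S_Ne"
proof
  fix f assume f: "f \<in> S_phi \<phi>"
  have "starlike_quot f \<prec>\<^sub>D nephroid"
  proof (rule subordinate_nephroid)
    show "starlike_quot f holomorphic_on ball 0 1"
      using f by (simp add: S_phi_def subordinate_def)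
    show "starlike_quot f 0 = 1" by (simp add: starlike_quot_def)
    show "starlike_quot f z \<noteq> nephroid \<zeta>" if "norm z < 1" "norm \<zeta> = 1" for z \<zeta>
      using S_phi_image[OF f, of z] that assms(2) by (metis imageE mem_ball_0)
  qed
  then show "f \<in> S_Ne"
    using f by (simp add: S_Ne_nephroid S_phi_def)
qed

text \<open>The extremal function whose quotient is \<open>\<phi>\<close> itself takes a real value
  that no quotient from \<open>S_Ne\<close> can take.\<close>

lemma S_phi_not_subset_S_Ne:
  assumes "\<phi> holomorphic_on ball 0 1" "\<phi> 0 = 1"
    and z: "norm z < 1" "\<phi> z = of_real x" "x \<le> 1 / 3 \<or> x \<ge> 5 / 3"
  shows "\<not> S_phi \<phi> \<subseteq> S_Ne"
proof
  assume sub: "S_phi \<phi> \<subseteq> S_Ne"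
  obtain f where f: "f \<in> S_phi \<phi>" "\<And>z. z \<in> ball 0 1 \<Longrightarrow> starlike_quot f z = \<phi> z"
    using exists_S_phi_quot[OF assms(1,2)] by blast
  have "\<phi> z \<in> nephroid ` ball 0 1"
    using S_phi_image[of f nephroid z] f sub z(1) by (auto simp: S_Ne_nephroid)
  then show False
    using nephroid_real_image[of x] z by auto
qed

text \<open>The factor \<open>a\<close> rotates the half-plane: \<open>a = 1\<close> serves the
  order of starlikeness, \<open>a = 4 sqrt 5 + i\<close> and its conjugate the two sides of the
  sector.\<close>

lemma S_Ne_bound:
  assumes "a \<noteq> 0" and bound: "\<And>\<zeta>. norm \<zeta> = 1 \<Longrightarrow> B \<le> Re (a * nephroid \<zeta>)"
    and "f \<in> S_Ne" "z \<in> ball 0 1"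
  shows "B < Re (a * starlike_quot f z)"
proof -
  obtain w where w: "w \<in> ball 0 1" "starlike_quot f z = nephroid w"
    using S_phi_image[of f nephroid z] assms by (auto simp: S_Ne_nephroid)
  have "B < Re (a * nephroid w)"
  proof (rule Re_gt_interior[of "\<lambda>w. a * nephroid w"])
    show "inj_on (\<lambda>w. a * nephroid w) (ball 0 1)"
      using nephroid_inj \<open>a \<noteq> 0\<close> by (simp add: inj_on_def)
  qed (use bound w in \<open>auto intro!: holomorphic_intros continuous_intros nephroid_continuous\<close>)
  with w show ?thesis by simp
qed

text \<open>For optimality: a bound assumed in the open disk passes by continuity to the circle,
  where the extremal values are attained.\<close>

lemma nephroid_bound_closed:
  assumes "\<And>z. norm z < 1 \<Longrightarrow> B \<le> Re (a * nephroid z)" and "norm \<zeta> = 1"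
  shows "B \<le> Re (a * nephroid \<zeta>)"
proof (rule continuous_ge_on_closure[of "ball 0 1" "\<lambda>z. Re (a * nephroid z)"])
  show "continuous_on (closure (ball 0 1)) (\<lambda>z. Re (a * nephroid z))"
    by (intro continuous_intros nephroid_continuous)
qed (use assms in auto)

section \<open>Starlikeness of order alpha and strong starlikeness\<close>

lemma nephroid_circle_Re_ge:
  assumes "norm \<zeta> = 1"
  shows "1 - 2 * sqrt 2 / 3 \<le> Re (nephroid \<zeta>)"
proof -
  \<comment> \<open>The rescaling \<open>t = sqrt 2 * x\<close> moves the minimizer
    \<open>x = - sqrt 2 / 2\<close> to \<open>t = -1\<close>, where the cubic has a double
    root.\<close>
  define x t where "x = Re \<zeta>" and "t = x / sqrt 2 * 2"
  have x: "x = t * sqrt 2 / 2"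
    by (simp add: t_def)
  have "t * sqrt 2 \<le> 2"
    using nephroid_circle(7)[OF assms] x by (simp add: x_def)
  moreover have "1 \<le> sqrt 2" by simp
  ultimately have "t \<le> 2"
    by (smt (verit) mult_le_cancel_left1 mult_less_cancel_left2)
  then have "0 \<le> (t + 1)^2 * (2 - t) * sqrt 2"
    by (intro mult_nonneg_nonneg) auto
  also have "\<dots> = 3 * (2 * x - 4 * x^3 / 3 + 2 * sqrt 2 / 3)"
  proof -
    have "x^3 = t^3 * (sqrt 2 * (sqrt 2)^2) / 8"
      unfolding x by (simp add: power3_eq_cube power2_eq_square)
    then have "x^3 = t^3 * sqrt 2 / 4" by simp
    then show ?thesis
      unfolding x by (simp add: field_simps power2_eq_square power3_eq_cube)
  qed
  finally show ?thesis
    using nephroid_circle(1)[OF assms] by (simp add: x_def)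
qed

lemma nephroid_Re_attained:
  obtains \<zeta> where "norm \<zeta> = 1" "Re (nephroid \<zeta>) = 1 - 2 * sqrt 2 / 3"
proof -
  define \<zeta> where "\<zeta> = Complex (- sqrt 2 / 2) (sqrt 2 / 2)"
  have "norm \<zeta> = 1" by (simp add: \<zeta>_def complex_norm power2_eq_square)
  moreover have "(sqrt 2)^3 = 2 * sqrt 2"
    by (simp add: power3_eq_cube)
  ultimately have "Re (nephroid \<zeta>) = 1 - 2 * sqrt 2 / 3"
    by (simp add: nephroid_circle(1) \<zeta>_def power_divide)
  with \<open>norm \<zeta> = 1\<close> that show ?thesis by blast
qed

lemma S_Ne_subset_S_order:
  assumes "\<alpha> \<le> 1 - 2 * sqrt 2 / 3"
  shows "S_Ne \<subseteq> S_order \<alpha>"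
proof
  fix f assume f: "f \<in> S_Ne"
  have "\<alpha> < Re (1 * starlike_quot f z)" if "z \<in> ball 0 1" for z
    by (rule S_Ne_bound[OF _ _ f that])
       (use nephroid_circle_Re_ge assms in \<open>auto intro: order_trans\<close>)
  then show "f \<in> S_order \<alpha>"
    using f by (simp add: S_order_def S_Ne_def S_phi_def subordinate_def)
qed

lemma S_Ne_not_subset_S_order:
  assumes "1 - 2 * sqrt 2 / 3 < \<alpha>"
  shows "\<not> S_Ne \<subseteq> S_order \<alpha>"
proof
  assume sub: "S_Ne \<subseteq> S_order \<alpha>"
  obtain f where f: "f \<in> S_Ne" "\<And>z. z \<in> ball 0 1 \<Longrightarrow> starlike_quot f z = nephroid z"
    using exists_S_phi_quot[of nephroid] nephroid_holomorphic by (metis S_Ne_nephroid nephroid_0)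
  have "\<alpha> \<le> Re (1 * nephroid z)" if "norm z < 1" for z
    using sub f that by (force simp: S_order_def)
  then have le: "\<alpha> \<le> Re (1 * nephroid \<zeta>)" if "norm \<zeta> = 1" for \<zeta>
    using nephroid_bound_closed that by blast
  obtain \<zeta> where "norm \<zeta> = 1" "Re (nephroid \<zeta>) = 1 - 2 * sqrt 2 / 3"
    by (rule nephroid_Re_attained)
  then show False
    using le[of \<zeta>] assms by simp
qed

section \<open>The smallest sector around the nephroid\<close>

text \<open>After squaring, the claim is \<open>(1 - x^2)^3 \<le> 45 * Re^2\<close>. The difference
  has a double root at \<open>x = -2/3\<close>, where the line of slope \<open>4 * sqrt 5\<close>
  touches the curve; the cofactor is a square plus \<open>2 - x^2\<close>.\<close>

lemma nephroid_circle_sector: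
  assumes "norm \<zeta> = 1"
  shows "\<bar>Im (nephroid \<zeta>)\<bar> \<le> 4 * sqrt 5 * Re (nephroid \<zeta>)"
proof (rule power2_le_imp_le)
  define x where "x = Re \<zeta>"
  note circ = nephroid_circle[OF assms, folded x_def]
  have x2: "x^2 \<le> 1" using circ(6,7) by (simp add: abs_square_le_1)
  have "(Im (nephroid \<zeta>))\<^sup>2 = 16 / 9 * ((Im \<zeta>)\<^sup>2)^3"
    unfolding circ(2) by (simp add: power_mult_distrib power2_eq_square)
  then have im: "(Im (nephroid \<zeta>))\<^sup>2 = 16 / 9 * (1 - x^2)^3"
    unfolding circ(5) .
  have "0 \<le> 9 * x^4 - 12 * x^3 - 15 * x^2 + 12 * x + 11"
  proof -
    have eq: "9 * x^4 - 12 * x^3 - 15 * x^2 + 12 * x + 11 = (3 * x^2 - 2 * x - 3)^2 + (2 - x^2)"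
      by (simp add: algebra_simps power_numeral_reduce)
    show ?thesis unfolding eq using x2 by (intro add_nonneg_nonneg) auto
  qed
  then have "0 \<le> (3 * x + 2)^2 * (9 * x^4 - 12 * x^3 - 15 * x^2 + 12 * x + 11)"
    by simp
  also have "\<dots> = 45 * (1 + 2 * x - 4 * x^3 / 3)^2 - (1 - x^2)^3"
    by (simp add: field_simps) (simp add: algebra_simps power_numeral_reduce)
  finally have "(1 - x^2)^3 \<le> 45 * (Re (nephroid \<zeta>))^2"
    using circ(1) by simp
  then show "\<bar>Im (nephroid \<zeta>)\<bar>\<^sup>2 \<le> (4 * sqrt 5 * Re (nephroid \<zeta>))\<^sup>2"
    using im by (simp add: power_mult_distrib)
  have "sqrt 2 \<le> 3 / 2" by (rule real_le_lsqrt) (auto simp: power2_eq_square)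
  then show "0 \<le> 4 * sqrt 5 * Re (nephroid \<zeta>)"
    using nephroid_circle_Re_ge[OF assms] by simp
qed

lemma nephroid_sector_attained:
  obtains \<zeta> where "norm \<zeta> = 1" "Re (nephroid \<zeta>) = 5 / 81" "Im (nephroid \<zeta>) = 20 * sqrt 5 / 81"
proof -
  define \<zeta> where "\<zeta> = Complex (- 2 / 3) (sqrt 5 / 3)"
  have n: "norm \<zeta> = 1" by (simp add: \<zeta>_def complex_norm power2_eq_square)
  moreover have "Re (nephroid \<zeta>) = 5 / 81"
    using n by (simp add: nephroid_circle(1) \<zeta>_def power_divide power3_eq_cube)
  moreover have "(sqrt 5)^3 = 5 * sqrt 5"
    by (simp add: power3_eq_cube)
  then have "Im (nephroid \<zeta>) = 20 * sqrt 5 / 81"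
    using n by (simp add: nephroid_circle(2) \<zeta>_def power_divide)
  ultimately show ?thesis using that by blast
qed

lemma abs_Arg_less_arctan_iff:
  assumes "Re w > 0"
  shows "\<bar>Arg w\<bar> < arctan t \<longleftrightarrow> \<bar>Im w\<bar> < t * Re w"
proof -
  have "\<bar>Arg w\<bar> = arctan \<bar>Im w / Re w\<bar>"
    using arg_conv_arctan[OF assms] by (simp add: abs_if arctan_minus)
  then show ?thesis
    using assms by (simp add: arctan_less_iff field_simps)
qed

lemma S_Ne_Re_pos:
  assumes "f \<in> S_Ne" "z \<in> ball 0 1"
  shows "Re (starlike_quot f z) > 0"
proof -
  have "sqrt 2 \<le> 3 / 2" by (rule real_le_lsqrt) (auto simp: power2_eq_square)
  then have "f \<in> S_order 0"
    using S_Ne_subset_S_order[of 0] assms by auto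
  then show ?thesis using assms by (simp add: S_order_def)
qed

lemma S_Ne_subset_SS_order:
  assumes "beta0 \<le> \<beta>"
  shows "S_Ne \<subseteq> SS_order \<beta>"
proof
  fix f assume f: "f \<in> S_Ne"
  have "starlike_quot f z \<noteq> 0 \<and> \<bar>Arg (starlike_quot f z)\<bar> < \<beta> * pi / 2"
    if z: "z \<in> ball 0 1" for z
  proof -
    let ?w = "starlike_quot f z"
    \<comment> \<open>The real part is \<open>4 * sqrt 5 * Re ?w - s * Im ?w\<close>, so the two
      signs give the two half-planes whose intersection is the sector.\<close>
    have bound: "0 < Re (Complex (4 * sqrt 5) s * ?w)" if "s = 1 \<or> s = -1" for s
    proof (rule S_Ne_bound[OF _ _ f z])
      show "Complex (4 * sqrt 5) s \<noteq> 0" by (simp add: complex_eq_iff)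
      show "0 \<le> Re (Complex (4 * sqrt 5) s * nephroid \<zeta>)" if "norm \<zeta> = 1" for \<zeta>
        using nephroid_circle_sector[OF that] \<open>s = 1 \<or> s = -1\<close> by auto
    qed
    have "\<bar>Im ?w\<bar> < 4 * sqrt 5 * Re ?w"
      using bound[of 1] bound[of "-1"] by auto
    then have "\<bar>Arg ?w\<bar> < arctan (4 * sqrt 5)"
      using abs_Arg_less_arctan_iff[OF S_Ne_Re_pos[OF f z]] by simp
    also have "\<dots> = beta0 * pi / 2" by (simp add: beta0_def)
    also have "\<dots> \<le> \<beta> * pi / 2" using assms by simp
    finally show ?thesis using S_Ne_Re_pos[OF f z] by auto
  qed
  then show "f \<in> SS_order \<beta>"
    using f by (simp add: SS_order_def S_Ne_def S_phi_def subordinate_def)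
qed

lemma S_Ne_not_subset_SS_order:
  assumes "0 < \<beta>" "\<beta> < beta0"
  shows "\<not> S_Ne \<subseteq> SS_order \<beta>"
proof
  assume sub: "S_Ne \<subseteq> SS_order \<beta>"
  obtain f where f: "f \<in> S_Ne" "\<And>z. z \<in> ball 0 1 \<Longrightarrow> starlike_quot f z = nephroid z"
    using exists_S_phi_quot[of nephroid] nephroid_holomorphic by (metis S_Ne_nephroid nephroid_0)
  have "\<beta> * pi / 2 < beta0 * pi / 2" using assms by simp
  also have b0: "beta0 * pi / 2 = arctan (4 * sqrt 5)" by (simp add: beta0_def)
  finally have lt: "\<beta> * pi / 2 < arctan (4 * sqrt 5)" .
  \<comment> \<open>Slope of the narrower sector. Its upper half-plane condition extends to the
    circle and fails at the tangency point, where \<open>Im / Re = 4 * sqrt 5 > t\<close>.\<close>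
  define t where "t = tan (\<beta> * pi / 2)"
  have "0 < \<beta> * pi / 2" using assms by simp
  then have at: "arctan t = \<beta> * pi / 2"
    unfolding t_def using lt arctan_ubound[of "4 * sqrt 5"] by (intro arctan_tan) linarith+
  then have t: "t < 4 * sqrt 5"
    using lt arctan_less_iff by metis
  have "0 \<le> Re (Complex t 1 * nephroid z)" if "norm z < 1" for z
  proof -
    have z: "z \<in> ball 0 1" using that by simp
    have "\<bar>Arg (nephroid z)\<bar> < arctan t"
      using sub f z at by (force simp: SS_order_def)
    then have "\<bar>Im (nephroid z)\<bar> < t * Re (nephroid z)"
      using abs_Arg_less_arctan_iff S_Ne_Re_pos[OF f(1) z] f(2)[OF z] by simp
    then show ?thesis by simp
  qed
  then have le: "0 \<le> Re (Complex t 1 * nephroid \<zeta>)" if "norm \<zeta> = 1" for \<zeta>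
    using nephroid_bound_closed that by blast
  obtain \<zeta> where \<zeta>: "norm \<zeta> = 1" "Re (nephroid \<zeta>) = 5 / 81" "Im (nephroid \<zeta>) = 20 * sqrt 5 / 81"
    by (rule nephroid_sector_attained)
  show False
    using le[of \<zeta>] \<zeta> t by simp
qed

section \<open>Classes contained in the nephroid class\<close>

text \<open>A value \<open>w = csqrt (1 + c z)\<close> satisfies
  \<open>norm (w^2 - 1) = c * norm z < c\<close>, so this bound keeps it off the curve. Factoring
  \<open>w^2 - 1\<close> makes the square a polynomial; the factor \<open>1 + x\<close> marks
  equality at \<open>w = 1/3\<close>.\<close>

lemma nephroid_circle_qc:
  assumes "norm \<zeta> = 1"
  shows "8 / 9 \<le> norm ((nephroid \<zeta>)\<^sup>2 - 1)"
proof (rule power2_le_imp_le)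
  define x where "x = Re \<zeta>"
  note circ = nephroid_circle[OF assms, folded x_def]
  have x2: "x^2 \<le> 1" using circ(6,7) by (simp add: abs_square_le_1)
  have eq: "144 * x^4 - 108 * x^3 - 300 * x^2 + 96 * x + 192
      = (12 * x^2 - 9 / 2 * x - 12)^2 + (129 / 4 * (1 - x^2) + 12 * (1 - x) + 15 / 4)"
    by (simp add: field_simps) (simp add: algebra_simps power_numeral_reduce)
  have "0 \<le> 144 * x^4 - 108 * x^3 - 300 * x^2 + 96 * x + 192"
    unfolding eq using x2 circ(7) by (intro add_nonneg_nonneg) auto
  then have "0 \<le> (1 + x) * (144 * x^4 - 108 * x^3 - 300 * x^2 + 96 * x + 192)"
    using circ(6) by simp
  also have "\<dots> = 4 * ((4 - 3 * x^2) * (13 + 18 * x - 3 * x^2 - 12 * x^3) - 4)"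
    by (simp add: algebra_simps power_numeral_reduce)
  also have "\<dots> = 81 / 4 * ((norm (nephroid \<zeta> - 1))\<^sup>2 * (norm (nephroid \<zeta> + 1))\<^sup>2 - 64 / 81)"
    unfolding circ(3,4) by (simp add: field_simps)
  also have "(norm (nephroid \<zeta> - 1))\<^sup>2 * (norm (nephroid \<zeta> + 1))\<^sup>2 = (norm ((nephroid \<zeta>)\<^sup>2 - 1))\<^sup>2"
    by (simp add: square_diff_one_factored[of "nephroid \<zeta>", folded power2_eq_square]
        norm_mult power_mult_distrib)
  finally show "(8 / 9)\<^sup>2 \<le> (norm ((nephroid \<zeta>)\<^sup>2 - 1))\<^sup>2"
    by (simp add: power2_eq_square)
qed simp

text \<open>The curve stays outside the open region bounded by the ellipse for
  \<open>k = 5/2\<close>. The factor \<open>1 - x\<close> in the difference of squares reflects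
  contact at the vertex \<open>5/3\<close>.\<close>

lemma nephroid_circle_conic:
  assumes "norm \<zeta> = 1"
  shows "Re (nephroid \<zeta>) \<le> 5 / 2 * norm (nephroid \<zeta> - 1)"
proof (rule power2_le_imp_le)
  define x where "x = Re \<zeta>"
  note circ = nephroid_circle[OF assms, folded x_def]
  have x2: "x^2 \<le> 1" using circ(6,7) by (simp add: abs_square_le_1)
  have "0 \<le> (1 + x) * (32 * (1 - x^2) + 24 * (1 - x) + 23)"
    using x2 circ(6,7) by (intro mult_nonneg_nonneg) auto
  moreover have "0 \<le> 16 * x^4 * (1 + x)"
    using circ(6) by simp
  ultimately have "0 \<le> (1 - x) * ((1 + x) * (32 * (1 - x^2) + 24 * (1 - x) + 23) + 16 * x^4 * (1 + x) + 12)"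
    using circ(7) by simp
  also have "\<dots> = 9 * (25 / 4 * (16 / 9 - 4 / 3 * x^2) - (1 + 2 * x - 4 * x^3 / 3)^2)"
    by (simp add: field_simps) (simp add: algebra_simps power_numeral_reduce)
  finally show "(Re (nephroid \<zeta>))\<^sup>2 \<le> (5 / 2 * norm (nephroid \<zeta> - 1))\<^sup>2"
    unfolding power_mult_distrib circ(1,3) by (simp add: power2_eq_square)
qed simp

text \<open>The disk of radius \<open>2/3\<close> about 1 is inscribed in the nephroid, touching it
  at \<open>1/3\<close> and \<open>5/3\<close>. The exponential and lemniscate classes are handled
  through this disk.\<close>

lemma nephroid_circle_dist:
  assumes "norm \<zeta> = 1"
  shows "2 / 3 \<le> norm (nephroid \<zeta> - 1)"
proof (rule power2_le_imp_le)
  have "(Re \<zeta>)^2 \<le> 1"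
    using nephroid_circle(6,7)[OF assms] by (simp add: abs_square_le_1)
  then show "(2 / 3)\<^sup>2 \<le> (norm (nephroid \<zeta> - 1))\<^sup>2"
    unfolding nephroid_circle(3)[OF assms] by (simp add: power2_eq_square)
qed simp

section \<open>The class of \<open>sqrt (1 + c z)\<close>\<close>

lemma S_qc_subset_S_Ne:
  assumes "0 < c" "c \<le> 8 / 9"
  shows "S_qc c \<subseteq> S_Ne"
  unfolding S_qc_def
proof (rule S_phi_subset_S_Ne)
  fix z \<zeta> :: complex assume z: "norm z < 1" and \<zeta>: "norm \<zeta> = 1"
  show "csqrt (1 + of_real c * z) \<noteq> nephroid \<zeta>"
  proof
    assume "csqrt (1 + of_real c * z) = nephroid \<zeta>"
    then have "(nephroid \<zeta>)\<^sup>2 - 1 = of_real c * z"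
      by (metis power2_csqrt add_diff_cancel_left')
    then have "norm ((nephroid \<zeta>)\<^sup>2 - 1) = c * norm z"
      using assms by (simp add: norm_mult)
    also have "\<dots> < c" using assms z by simp
    finally show False using nephroid_circle_qc[OF \<zeta>] assms by linarith
  qed
qed simp

lemma one_plus_not_nonpos_Reals:
  fixes z :: complex
  assumes "norm z < 1"
  shows "1 + z \<notin> \<real>\<^sub>\<le>\<^sub>0"
  using assms abs_Re_le_cmod[of z] by (auto simp: complex_nonpos_Reals_iff)

lemma S_qc_not_subset_S_Ne:
  assumes "8 / 9 < c" "c \<le> 1"
  shows "\<not> S_qc c \<subseteq> S_Ne"
  unfolding S_qc_def
\<comment> \<open>At this point \<open>1 + c z = 1/9\<close>, whose principal root is the excluded
  value \<open>1/3\<close>.\<close>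
proof (rule S_phi_not_subset_S_Ne[where z = "of_real (- (8 / 9) / c)" and x = "1 / 3"])
  have "norm (of_real c * z) < 1" if "norm z < 1" for z :: complex
  proof -
    have "c * norm z \<le> 1 * norm z" using assms by (intro mult_right_mono) auto
    then show ?thesis using that assms by (simp add: norm_mult)
  qed
  then show "(\<lambda>z. csqrt (1 + of_real c * z)) holomorphic_on ball 0 1"
    by (intro holomorphic_intros one_plus_not_nonpos_Reals) auto
  show "norm (complex_of_real (- (8 / 9) / c)) < 1"
    using assms by (simp add: norm_divide)
  have "1 + complex_of_real c * of_real (- (8 / 9) / c) = of_real (1 / 9)"
    using assms by (simp add: field_simps)
  also have "csqrt \<dots> = of_real (sqrt (1 / 9))"
    by (rule csqrt_of_real) simp
  also have "sqrt (1 / 9) = 1 / 3"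
    by (rule real_sqrt_unique) (auto simp: power2_eq_square)
  finally show "csqrt (1 + complex_of_real c * of_real (- (8 / 9) / c)) = of_real (1 / 3)" .
qed auto

section \<open>The uniformly starlike classes\<close>

lemma k_ST_subset_S_Ne:
  assumes "k \<ge> 5 / 2"
  shows "k_ST k \<subseteq> S_Ne"
proof
  fix f assume f: "f \<in> k_ST k"
  have "starlike_quot f \<prec>\<^sub>D nephroid"
  proof (rule subordinate_nephroid)
    show "starlike_quot f holomorphic_on ball 0 1"
      using f by (simp add: k_ST_def)
    show "starlike_quot f 0 = 1" by (simp add: starlike_quot_def)
    show "starlike_quot f z \<noteq> nephroid \<zeta>" if "norm z < 1" "norm \<zeta> = 1" for z \<zeta>
    proof
      assume "starlike_quot f z = nephroid \<zeta>"
      then have "k * norm (nephroid \<zeta> - 1) < Re (nephroid \<zeta>)"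
        using f that(1) by (force simp: k_ST_def conic_region_def)
      moreover have "5 / 2 * norm (nephroid \<zeta> - 1) \<le> k * norm (nephroid \<zeta> - 1)"
        using assms by (intro mult_right_mono) auto
      ultimately show False using nephroid_circle_conic[OF that(2)] by linarith
    qed
  qed
  then show "f \<in> S_Ne"
    using f by (simp add: S_Ne_nephroid S_phi_def k_ST_def)
qed

text \<open>
  The disk with diameter \<open>[13/15, 5/3]\<close> lies in the ellipse for \<open>k = 5/2\<close> and osculates it at the
  vertex \<open>5/3\<close>; the map \<open>z \<mapsto> 1 + 2/3 \<cdot> z/(3 - 2z)\<close> sends the unit disk onto it and \<open>0\<close> to \<open>1\<close>.
\<close>

lemma osculating_disk:
  assumes "norm z < 1"
  defines "u \<equiv> z / (3 - 2 * z)"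
  shows "5 * norm u \<le> 3 + 2 * Re u" and "13 / 5 \<le> 3 + 2 * Re u"
proof -
  \<comment> \<open>\<open>m\<close> is a disk automorphism applied to \<open>z\<close>, and
    \<open>u\<close> is affine in \<open>m\<close>: it lies in the disk with center
    \<open>2/5\<close> and radius \<open>3/5\<close>. The first claim is
    \<open>5/2 * norm (w - 1) \<le> Re w\<close> for \<open>w = 1 + 2/3 u\<close>.\<close>
  define m where "m = (3 * z - 2) / (3 - 2 * z)"
  have "norm (2 * z) < norm (3 :: complex)" using assms(1) by (simp add: norm_mult)
  then have nz: "3 - 2 * z \<noteq> 0" by (metis eq_iff_diff_eq_0 less_irrefl)
  have u: "u = (2 + 3 * m) / 5"
    using nz by (simp add: u_def m_def field_simps)
  have "(norm z)\<^sup>2 < 1"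
    using assms(1) by (simp add: power_less_one_iff)
  then have "(norm (3 * z - 2))\<^sup>2 \<le> (norm (3 - 2 * z))\<^sup>2"
    unfolding cmod_power2 by (simp add: power2_eq_square algebra_simps)
  then have "norm (3 * z - 2) \<le> norm (3 - 2 * z)"
    by (rule power2_le_imp_le) simp
  then have m: "norm m \<le> 1"
    using nz by (simp add: m_def norm_divide divide_le_eq)
  then have m2: "(Re m)\<^sup>2 + (Im m)\<^sup>2 \<le> 1"
    using cmod_power2[of m] power_le_one[of "norm m" 2] by simp
  have rm: "-1 \<le> Re m" using abs_Re_le_cmod[of m] m by linarith
  have re: "Re u = 2 / 5 + 3 / 5 * Re m" "Im u = 3 / 5 * Im m"
    by (simp_all add: u add_divide_distrib)
  show R: "13 / 5 \<le> 3 + 2 * Re u" using rm unfolding re by (simp add: field_simps)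
  show "5 * norm u \<le> 3 + 2 * Re u"
  proof (rule power2_le_imp_le)
    have "(5 * norm u)\<^sup>2 = 4 + 12 * Re m + 9 * ((Re m)\<^sup>2 + (Im m)\<^sup>2)"
      unfolding power_mult_distrib cmod_power2 re by (simp add: field_simps power2_eq_square)
    also have "\<dots> \<le> 13 + 12 * Re m" using m2 by simp
    \<comment> \<open>The added square completes \<open>(3 + 2 * Re u)^2\<close>; it vanishes at
      \<open>m = 1\<close>, the vertex.\<close>
    also have "\<dots> \<le> 13 + 12 * Re m + 36 / 25 * (1 - Re m)\<^sup>2" by simp
    also have "\<dots> = (3 + 2 * Re u)\<^sup>2"
      unfolding re by (simp add: field_simps power2_eq_square)
    finally show "(5 * norm u)\<^sup>2 \<le> (3 + 2 * Re u)\<^sup>2" .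
  qed (use R in linarith)
qed

text \<open>For \<open>k < 5/2\<close> there is room to dilate the osculating disk about 1 by some
  \<open>s > 1\<close> inside the conic region. The dilated disk contains
  \<open>5/3\<close>.\<close>

lemma k_ST_not_subset_S_Ne:
  assumes "0 \<le> k" "k < 5 / 2"
  shows "\<not> k_ST k \<subseteq> S_Ne"
proof
  assume sub: "k_ST k \<subseteq> S_Ne"
  define d where "d = 1 - 2 * k / 5"
  \<comment> \<open>The region condition reads
    \<open>3 * s - 3 < s * (3 + 2 * Re u - 2 * k * norm u)\<close>. The right side is at least
    \<open>13/5 * d\<close>, while this \<open>s\<close> makes the left side
    \<open>3/2 * d\<close>.\<close>
  define s where "s = 1 + d / 2"
  have d: "0 < d" "d \<le> 1" using assms by (auto simp: d_def)
  have s: "1 < s" using d by (simp add: s_def)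
  define q where "q = (\<lambda>z. 1 + 2 / 3 * of_real s * (z / (3 - 2 * z)) :: complex)"
  have nz: "3 - 2 * z \<noteq> 0" if "norm z < 1" for z :: complex
  proof -
    have "norm (2 * z) < norm (3 :: complex)" using that by (simp add: norm_mult)
    then show ?thesis by (metis eq_iff_diff_eq_0 less_irrefl)
  qed
  have hol: "q holomorphic_on ball 0 1"
    unfolding q_def using nz by (intro holomorphic_intros) auto
  obtain f where f: "f \<in> normalized_analytic"
    "\<And>z. z \<in> ball 0 1 \<Longrightarrow> starlike_quot f z = q z"
    using exists_starlike_quot[OF hol] by (auto simp: q_def)
  have region: "q z \<in> conic_region k" if z: "z \<in> ball 0 1" for z
  proof -
    define u where "u = z / (3 - 2 * z)"
    have u: "5 * norm u \<le> 3 + 2 * Re u" "13 / 5 \<le> 3 + 2 * Re u"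
      using osculating_disk[of z] z by (auto simp: u_def)
    have "k * (5 * norm u) \<le> k * (3 + 2 * Re u)"
      using u assms by (intro mult_left_mono) auto
    then have "d * (3 + 2 * Re u) \<le> 3 + 2 * Re u - 2 * k * norm u"
      by (simp add: d_def algebra_simps)
    moreover have "d * (13 / 5) \<le> d * (3 + 2 * Re u)"
      using u d by (intro mult_left_mono) auto
    ultimately have "d * (13 / 5) \<le> 3 + 2 * Re u - 2 * k * norm u" by linarith
    then have "s * (d * (13 / 5)) \<le> s * (3 + 2 * Re u - 2 * k * norm u)"
      using s by (intro mult_left_mono) auto
    moreover have "1 * (d * (13 / 5)) \<le> s * (d * (13 / 5))"
      using s d by (intro mult_right_mono) auto
    ultimately have "3 * s - 3 < s * (3 + 2 * Re u - 2 * k * norm u)"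
      using d s_def by linarith
    then have "2 * k * s * norm u < 3 + 2 * s * Re u"
      by (simp add: algebra_simps)
    moreover have "q z = 1 + of_real (2 / 3 * s) * u" by (simp add: q_def u_def)
    then have "norm (q z - 1) = 2 / 3 * s * norm u" "Re (q z) = 1 + 2 / 3 * s * Re u"
      using s by (simp_all add: norm_mult)
    ultimately show ?thesis
      unfolding conic_region_def mem_Collect_eq by (simp only:)
  qed
  have "starlike_quot f holomorphic_on ball 0 1"
    using hol by (rule holomorphic_transform) (simp add: f)
  then have "f \<in> k_ST k"
    using f region by (auto simp: k_ST_def)
  then have "f \<in> S_phi nephroid" using sub S_Ne_nephroid by auto
  \<comment> \<open>Solves \<open>s * t / (3 - 2 * t) = 1\<close>, so \<open>q\<close> takes the
    value \<open>5/3\<close> at \<open>t\<close>.\<close>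
  moreover define t where "t = 3 / (s + 2)"
  have t: "0 < t" "t < 1" using s by (auto simp: t_def)
  ultimately have "q (of_real t) \<in> nephroid ` ball 0 1"
    using S_phi_image[of f nephroid "of_real t"] f(2)[of "of_real t"] by auto
  moreover have "q (of_real t) = of_real (1 + 2 / 3 * (s * (t / (3 - 2 * t))))"
    by (simp add: q_def)
  ultimately have lt: "1 + 2 / 3 * (s * (t / (3 - 2 * t))) < 5 / 3"
    by (intro nephroid_real_image(2)) (simp only:)
  have "3 - 2 * t = s * t"
    using s by (simp add: t_def field_simps)
  then have "s * (t / (3 - 2 * t)) = 1"
    using s t by simp
  with lt show False by (simp only:)
qed

section \<open>The exponential class\<close>

text \<open>The power series of \<open>exp z - 1\<close> has nonnegative coefficients, so it is
  bounded termwise by its value at \<open>norm z\<close>.\<close>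

lemma norm_exp_minus_one_le:
  fixes z :: complex
  shows "norm (exp z - 1) \<le> exp (norm z) - 1"
proof (rule norm_sums_le)
  show "(\<lambda>n. z ^ Suc n /\<^sub>R fact (Suc n)) sums (exp z - 1)"
    using exp_converges[of z] by (subst sums_Suc_iff) simp
  show "(\<lambda>n. norm z ^ Suc n /\<^sub>R fact (Suc n)) sums (exp (norm z) - 1)"
    using exp_converges[of "norm z"] by (subst sums_Suc_iff) simp
qed (simp add: norm_mult norm_power norm_divide)

lemma S_exp_subset_S_Ne:
  assumes "1 - (2 / 3) / (exp 1 - 1) \<le> \<alpha>" "\<alpha> < 1"
  shows "S_exp \<alpha> \<subseteq> S_Ne"
  unfolding S_exp_def
proof (rule S_phi_subset_S_Ne)
  fix z \<zeta> :: complex assume z: "norm z < 1" and \<zeta>: "norm \<zeta> = 1"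
  have e: "exp 1 - 1 > (0::real)" by simp
  show "of_real \<alpha> + (1 - of_real \<alpha>) * exp z \<noteq> nephroid \<zeta>"
  proof
    assume "of_real \<alpha> + (1 - of_real \<alpha>) * exp z = nephroid \<zeta>"
    then have "nephroid \<zeta> - 1 = of_real (1 - \<alpha>) * (exp z - 1)"
      by (auto simp: algebra_simps)
    then have "norm (nephroid \<zeta> - 1) = (1 - \<alpha>) * norm (exp z - 1)"
      using assms by (simp add: norm_mult del: of_real_diff)
    also have "\<dots> \<le> (1 - \<alpha>) * (exp (norm z) - 1)"
      using assms norm_exp_minus_one_le[of z] by (intro mult_left_mono) auto
    also have "\<dots> < (1 - \<alpha>) * (exp 1 - 1)"
      using assms z by simp
    also have "\<dots> \<le> 2 / 3"
      using assms e by (simp add: field_simps)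
    finally show False using nephroid_circle_dist[OF \<zeta>] by linarith
  qed
qed simp

lemma S_exp_not_subset_S_Ne:
  assumes "\<alpha> < 1 - (2 / 3) / (exp 1 - 1)"
  shows "\<not> S_exp \<alpha> \<subseteq> S_Ne"
proof -
  have e: "exp 1 - 1 > (0::real)" by simp
  then have "0 < (2 / 3) / (exp 1 - 1 :: real)" by (intro divide_pos_pos) auto
  then have \<alpha>: "\<alpha> < 1" using assms by linarith
  \<comment> \<open>Solves \<open>\<alpha> + (1 - \<alpha>) * exp t = 5/3\<close>; the assumption on
    \<open>\<alpha>\<close> is what gives \<open>t < 1\<close>.\<close>
  define t where "t = ln (1 + (2 / 3) / (1 - \<alpha>))"
  have pos: "0 < (2 / 3) / (1 - \<alpha>)" using \<alpha> by simp
  then have t0: "0 < t" unfolding t_def by (intro ln_gt_zero) linarith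
  have et: "exp t = 1 + (2 / 3) / (1 - \<alpha>)"
    unfolding t_def using pos by (intro exp_ln) linarith
  have "(2 / 3) / (1 - \<alpha>) < exp 1 - 1"
    using assms \<alpha> e by (simp add: field_simps)
  then have "exp t < exp 1" using et by simp
  then have t1: "t < 1" by simp
  show ?thesis
    unfolding S_exp_def
  proof (rule S_phi_not_subset_S_Ne[where z = "of_real t" and x = "5 / 3"])
    show "(\<lambda>z. of_real \<alpha> + (1 - of_real \<alpha>) * exp z) holomorphic_on ball 0 1"
      by (intro holomorphic_intros)
    have "complex_of_real \<alpha> + (1 - of_real \<alpha>) * exp (of_real t)
        = of_real (\<alpha> + (1 - \<alpha>) * exp t)"
      by (simp add: exp_of_real)
    also have "\<alpha> + (1 - \<alpha>) * exp t = 5 / 3"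
      using \<alpha> by (simp add: et field_simps)
    finally show "complex_of_real \<alpha> + (1 - of_real \<alpha>) * exp (of_real t) = of_real (5 / 3)" .
  qed (use t0 t1 in auto)
qed

section \<open>The lemniscate class\<close>

text \<open>With \<open>w\<close> the principal root, \<open>(w - 1) * (w + 1) = z\<close>, and
  \<open>Re w \<ge> 0\<close> gives \<open>norm (w + 1) \<ge> 1\<close>.\<close>

lemma norm_csqrt_one_plus_less:
  assumes "norm z < 1"
  shows "norm (csqrt (1 + z) - 1) < 1"
proof -
  let ?w = "csqrt (1 + z)"
  have "Re ?w \<ge> 0" by (rule Re_csqrt)
  then have "1 \<le> norm (?w + 1)"
    using complex_Re_le_cmod[of "?w + 1"] by (simp del: csqrt.sel)
  then have "norm (?w - 1) * 1 \<le> norm (?w - 1) * norm (?w + 1)"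
    by (intro mult_left_mono) auto
  also have "\<dots> = norm (?w\<^sup>2 - 1)"
    by (simp add: norm_mult[symmetric] power2_eq_square algebra_simps)
  finally show ?thesis using assms by simp
qed

lemma S_L_subset_S_Ne:
  assumes "1 / 3 \<le> \<alpha>" "\<alpha> < 1"
  shows "S_L \<alpha> \<subseteq> S_Ne"
  unfolding S_L_def
proof (rule S_phi_subset_S_Ne)
  fix z \<zeta> :: complex assume z: "norm z < 1" and \<zeta>: "norm \<zeta> = 1"
  show "of_real \<alpha> + (1 - of_real \<alpha>) * csqrt (1 + z) \<noteq> nephroid \<zeta>"
  proof
    assume "of_real \<alpha> + (1 - of_real \<alpha>) * csqrt (1 + z) = nephroid \<zeta>"
    then have "nephroid \<zeta> - 1 = of_real (1 - \<alpha>) * (csqrt (1 + z) - 1)"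
      by (auto simp: algebra_simps)
    then have "norm (nephroid \<zeta> - 1) = (1 - \<alpha>) * norm (csqrt (1 + z) - 1)"
      using assms by (simp add: norm_mult del: of_real_diff)
    also have "\<dots> < 1 - \<alpha>"
      using assms norm_csqrt_one_plus_less[OF z] by simp
    finally show False using nephroid_circle_dist[OF \<zeta>] assms by linarith
  qed
qed simp

lemma S_L_not_subset_S_Ne:
  assumes "0 \<le> \<alpha>" "\<alpha> < 1 / 3"
  shows "\<not> S_L \<alpha> \<subseteq> S_Ne"
proof -
  \<comment> \<open>Solves \<open>\<alpha> + (1 - \<alpha>) * s = 1/3\<close>. Since
    \<open>s > 0\<close>, it is the principal root of \<open>1 + z\<close> at
    \<open>z = s^2 - 1\<close>.\<close>
  define s where "s = 1 - (2 / 3) / (1 - \<alpha>)"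
  have s: "0 < s" "s < 1" using assms by (auto simp: s_def field_simps)
  then have s2: "0 < s\<^sup>2" "s\<^sup>2 < 1" by (auto simp: power_less_one_iff)
  show ?thesis
    unfolding S_L_def
  proof (rule S_phi_not_subset_S_Ne[where z = "of_real (s\<^sup>2 - 1)" and x = "1 / 3"])
    show "(\<lambda>z. of_real \<alpha> + (1 - of_real \<alpha>) * csqrt (1 + z)) holomorphic_on ball 0 1"
      by (intro holomorphic_intros one_plus_not_nonpos_Reals) auto
    have "csqrt (1 + complex_of_real (s\<^sup>2 - 1)) = of_real s"
      using s csqrt_of_real[of "s\<^sup>2"] by (simp del: csqrt.sel)
    then have "complex_of_real \<alpha> + (1 - of_real \<alpha>) * csqrt (1 + complex_of_real (s\<^sup>2 - 1))
        = of_real (\<alpha> + (1 - \<alpha>) * s)"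
      by simp
    also have "\<alpha> + (1 - \<alpha>) * s = 1 / 3"
      using assms by (simp add: s_def field_simps)
    finally show "complex_of_real \<alpha> + (1 - of_real \<alpha>) * csqrt (1 + complex_of_real (s\<^sup>2 - 1))
        = of_real (1 / 3)" .
    show "norm (complex_of_real (s\<^sup>2 - 1)) < 1"
      using s2 unfolding norm_of_real by linarith
  qed auto
qed

theorem theorem3p1:
  shows
    "(\<forall>\<alpha>::real. 0 \<le> \<alpha> \<and> \<alpha> \<le> 1 - 2 * sqrt 2 / 3 \<longrightarrow> S_Ne \<subseteq> S_order \<alpha>) \<and>
     (\<forall>\<beta>::real. beta0 \<le> \<beta> \<and> \<beta> \<le> 1 \<longrightarrow> S_Ne \<subseteq> SS_order \<beta>) \<and>
     (\<forall>c::real. 0 < c \<and> c \<le> 8 / 9 \<longrightarrow> S_qc c \<subseteq> S_Ne) \<and>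
     (\<forall>k::real. k \<ge> 5 / 2 \<longrightarrow> k_ST k \<subseteq> S_Ne) \<and>
     (\<forall>\<alpha>::real. 1 - (2 / 3) / (exp 1 - 1) \<le> \<alpha> \<and> \<alpha> < 1 \<longrightarrow> S_exp \<alpha> \<subseteq> S_Ne) \<and>
     (\<forall>\<alpha>::real. 1 / 3 \<le> \<alpha> \<and> \<alpha> < 1 \<longrightarrow> S_L \<alpha> \<subseteq> S_Ne) \<and>
     (\<forall>\<alpha>::real. 1 - 2 * sqrt 2 / 3 < \<alpha> \<and> \<alpha> < 1 \<longrightarrow> \<not> S_Ne \<subseteq> S_order \<alpha>) \<and>
     (\<forall>\<beta>::real. 0 < \<beta> \<and> \<beta> < beta0 \<longrightarrow> \<not> S_Ne \<subseteq> SS_order \<beta>) \<and>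
     (\<forall>c::real. 8 / 9 < c \<and> c \<le> 1 \<longrightarrow> \<not> S_qc c \<subseteq> S_Ne) \<and>
     (\<forall>k::real. 0 \<le> k \<and> k < 5 / 2 \<longrightarrow> \<not> k_ST k \<subseteq> S_Ne) \<and>
     (\<forall>\<alpha>::real. 0 \<le> \<alpha> \<and> \<alpha> < 1 - (2 / 3) / (exp 1 - 1) \<longrightarrow> \<not> S_exp \<alpha> \<subseteq> S_Ne) \<and>
     (\<forall>\<alpha>::real. 0 \<le> \<alpha> \<and> \<alpha> < 1 / 3 \<longrightarrow> \<not> S_L \<alpha> \<subseteq> S_Ne)"
  by (intro conjI allI impI; (elim conjE)?;
      intro S_Ne_subset_S_order S_Ne_subset_SS_order S_qc_subset_S_Ne k_ST_subset_S_Ne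
        S_exp_subset_S_Ne S_L_subset_S_Ne S_Ne_not_subset_S_order S_Ne_not_subset_SS_order
        S_qc_not_subset_S_Ne k_ST_not_subset_S_Ne S_exp_not_subset_S_Ne S_L_not_subset_S_Ne;
      assumption)

end
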